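(* Let $k$ be a field of characteristic zero, let $\Delta$ be a simplicial complex on $V=\{x_1,\ldots,x_n\}$ with set of facets $\mathcal{F}(\Delta)$ and no facet of cardinality one, and let $A=A(\Delta,a_1,\ldots,a_n)$ for any choice of integers $a_i\geq 2$. Then: (i) the Cohen-Macaulay type of $A$ equals $|\mathcal{F}(\Delta)|$, and is therefore independent of the $a_i$'s; (ii) $A(\Delta,a_1,\ldots,a_n)$ is Gorenstein if and only if $\Delta$ has a unique facet.
   Context: A simplicial complex $\Delta$ on $V=\{x_1,\ldots,x_n\}$ ($n\ge 1$) is a collection of subsets of $V$ (faces) closed under taking subsets and with $\{x_i\}\in\Delta$ for all $i$; its facets are its faces that are maximal under inclusion. Let $R=k[x_1,\ldots,x_n]$ with $\deg x_i=1$. The Stanley-Reisner ideal is $I_\Delta=(x_{i_1}\cdots x_{i_s} \mid \{x_{i_1},\ldots,x_{i_s}\}\notin\Delta)\subseteq R$ (squarefree monomials). For integers $a_i\ge 2$, set $A(\Delta,a_1,\ldots,a_n)=R/(I_\Delta+(x_1^{a_1},\ldots,x_n^{a_n}))$, a graded artinian algebra. For a graded artinian algebra $A=R/I$, $\operatorname{soc}(A)=\{a\in A\mid a\overline{x}_i=0 \text{ for all } i\}$, and the socle-vector is $s(A)=(s_0,\ldots,s_e)$ with $s_i=\dim_k \operatorname{soc}(A)_i$, where $e$ is the largest index with $A_e\neq 0$. The (Cohen-Macaulay) type of $A$ is $\sum_{i=0}^e s_i$. $A$ is level (of type $t$) if $s(A)=(0,\ldots,0,s_e=t)$, and Gorenstein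 if it is level of type $t=1$. *)

theory Defs
  imports
    "HOL-Library.Poly_Mapping"
    "HOL-Algebra.QuotRing"
    "HOL-Algebra.Embedded_Algebras"
    "HOL-Algebra.Algebraic_Closure_Type"
begin

text \<open>The vertices \<open>x\<^sub>1, \<dots>, x\<^sub>n\<close> are the elements of a finite (hence nonempty) type \<open>'v\<close>,
  so \<open>n = CARD('v) \<ge> 1\<close>.\<close>

definition simplicial_complex :: "'v set set \<Rightarrow> bool" where
  "simplicial_complex \<Delta> \<longleftrightarrow>
     (\<forall>F\<in>\<Delta>. \<forall>G. G \<subseteq> F \<longrightarrow> G \<in> \<Delta>) \<and> (\<forall>i. {i} \<in> \<Delta>)"

definition facets :: "'v set set \<Rightarrow> 'v set set" where
  "facets \<Delta> = {F \<in> \<Delta>. \<forall>G\<in>\<Delta>. F \<subseteq> G \<longrightarrow> G = F}"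

text \<open>Elements of \<open>R = k[x\<^sub>1, \<dots>, x\<^sub>n]\<close>: finitely supported maps from exponent vectors to
  coefficients, multiplied by convolution.\<close>

type_synonym ('v, 'k) mpoly = "('v \<Rightarrow>\<^sub>0 nat) \<Rightarrow>\<^sub>0 'k"

definition var :: "'v \<Rightarrow> ('v, 'k::field) mpoly" where
  "var i = Poly_Mapping.single (Poly_Mapping.single i 1) 1"

definition const :: "'k::field \<Rightarrow> ('v, 'k) mpoly" where
  "const c = Poly_Mapping.single 0 c"

definition homogeneous :: "nat \<Rightarrow> ('v::finite, 'k::field) mpoly \<Rightarrow> bool" where
  "homogeneous d f \<longleftrightarrow> (\<forall>m\<in>Poly_Mapping.keys f. (\<Sum>i\<in>UNIV. Poly_Mapping.lookup m i) = d)"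

abbreviation mpoly_ring :: "('v, 'k::field) mpoly ring" where
  "mpoly_ring \<equiv> ring_of_type_algebra"

definition stanley_reisner_ideal :: "'v set set \<Rightarrow> ('v, 'k::field) mpoly set" where
  "stanley_reisner_ideal \<Delta> = Idl\<^bsub>mpoly_ring\<^esub> {\<Prod>i\<in>S. var i | S. S \<notin> \<Delta>}"

text \<open>The defining ideal of \<open>A(\<Delta>, a\<^sub>1, \<dots>, a\<^sub>n)\<close>.\<close>

definition artinian_ideal :: "'v set set \<Rightarrow> ('v \<Rightarrow> nat) \<Rightarrow> ('v, 'k::field) mpoly set" where
  "artinian_ideal \<Delta> a =
     stanley_reisner_ideal \<Delta> <+>\<^bsub>mpoly_ring\<^esub> Idl\<^bsub>mpoly_ring\<^esub> {var i ^ a i | i. True}"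

text \<open>The grading, the \<open>k\<close>-structure and the distinguished generators of a graded algebra
  \<open>A = R/I\<close> all come from its presentation, so the notions below take the homogeneous ideal \<open>I\<close>
  as their argument. The elements of \<open>A\<close> are the cosets of \<open>I\<close>.\<close>

abbreviation quotient_algebra :: "('v, 'k::field) mpoly set \<Rightarrow> ('v, 'k) mpoly set ring" where
  "quotient_algebra I \<equiv> mpoly_ring Quot I"

definition residue_class :: "('v, 'k::field) mpoly set \<Rightarrow> ('v, 'k) mpoly \<Rightarrow> ('v, 'k) mpoly set" where
  "residue_class I f = I +>\<^bsub>mpoly_ring\<^esub> f"

definition graded_piece :: "('v::finite, 'k::field) mpoly set \<Rightarrow> nat \<Rightarrow> ('v, 'k) mpoly set set" where
  "graded_piece I d = residue_class I ` {f. homogeneous d f}"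

definition socle :: "('v, 'k::field) mpoly set \<Rightarrow> ('v, 'k) mpoly set set" where
  "socle I = {c \<in> carrier (quotient_algebra I).
     \<forall>i. c \<otimes>\<^bsub>quotient_algebra I\<^esub> residue_class I (var i) = \<zero>\<^bsub>quotient_algebra I\<^esub>}"

text \<open>Dimension of a subspace of \<open>R/I\<close> over the copy of \<open>k\<close> formed by the classes of the
  constants; this copy is a subfield when \<open>I\<close> is a proper ideal.\<close>

definition k_dim :: "('v, 'k::field) mpoly set \<Rightarrow> ('v, 'k) mpoly set set \<Rightarrow> nat" where
  "k_dim I E = ring.dim (quotient_algebra I) (residue_class I ` range const) E"

text \<open>The largest \<open>e\<close> with \<open>A\<^sub>e \<noteq> 0\<close>; it exists since \<open>A\<close> is artinian and nonzero.\<close>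

definition socle_degree :: "('v::finite, 'k::field) mpoly set \<Rightarrow> nat" where
  "socle_degree I = Max {d. graded_piece I d \<noteq> {\<zero>\<^bsub>quotient_algebra I\<^esub>}}"

definition socle_vector :: "('v::finite, 'k::field) mpoly set \<Rightarrow> nat list" where
  "socle_vector I =
     map (\<lambda>d. k_dim I (socle I \<inter> graded_piece I d)) [0..<Suc (socle_degree I)]"

definition cm_type :: "('v::finite, 'k::field) mpoly set \<Rightarrow> nat" where
  "cm_type I = sum_list (socle_vector I)"

definition level_of_type :: "('v::finite, 'k::field) mpoly set \<Rightarrow> nat \<Rightarrow> bool" where
  "level_of_type I t \<longleftrightarrow> socle_vector I = replicate (socle_degree I) 0 @ [t]"

definition gorenstein :: "('v::finite, 'k::field) mpoly set \<Rightarrow> bool" where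
  "gorenstein I \<longleftrightarrow> level_of_type I 1"

end

theory Submission
  imports Defs
begin

text \<open>The defining ideal \<open>I\<close> is spanned by the monomials whose exponent vector is supported on a
  nonface or has some entry at least \<open>a\<^sub>i\<close>; hence \<open>R/I\<close> has the remaining monomials as a basis, and
  its socle is spanned by those among them that are killed by every variable. Such a monomial is
  supported on a face \<open>F\<close>, every exponent on \<open>F\<close> is maximal, that is \<open>a\<^sub>i - 1\<close>, and (as
  \<open>a\<^sub>j \<ge> 2\<close>) no vertex can be added to \<open>F\<close>. So the socle monomials are the
  \<open>\<Prod>\<^bsub>i\<in>F\<^esub> x\<^sub>i\<^bsup>a\<^sub>i - 1\<^esup>\<close>, one for each facet \<open>F\<close>. Finally \<open>A\<^sub>e\<close> lies in the socle, so a socle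
  of dimension one is concentrated in degree \<open>e\<close>.\<close>

subsection \<open>The polynomial ring and its quotients\<close>

lemma mpoly_ring_simps [simp]:
  "carrier mpoly_ring = UNIV"
  "x \<otimes>\<^bsub>mpoly_ring\<^esub> y = x * y"
  "\<one>\<^bsub>mpoly_ring\<^esub> = 1"
  "\<zero>\<^bsub>mpoly_ring\<^esub> = 0"
  "x \<oplus>\<^bsub>mpoly_ring\<^esub> y = x + y"
  by (simp_all add: ring_of_type_algebra_def)

interpretation mpoly: cring "mpoly_ring :: ('v, 'k::field) mpoly ring"
  by (rule cring_from_type_algebra)

lemma mpoly_ring_a_inv [simp]: "\<ominus>\<^bsub>mpoly_ring\<^esub> (x :: ('v, 'k::field) mpoly) = - x"
  by (rule mpoly.minus_equality) simp_all

section \<open>Monomial multiplication and ideals determined by supports\<close>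

lemma lookup_single_mult:
  "Poly_Mapping.lookup (Poly_Mapping.single t c * f) (t + m) = c * Poly_Mapping.lookup f m"
  for f :: "('v, 'k::field) mpoly"
proof -
  have "Poly_Mapping.lookup (Poly_Mapping.single t c * f) (t + m) =
    (\<Sum>l. (c * (\<Sum>q. Poly_Mapping.lookup f q when t + m = l + q)) when t = l)"
    by (simp add: lookup_mult lookup_single when_mult)
  \<comment> \<open>Only the summand \<open>l = t\<close> survives, and cancelling \<open>t\<close>
    in the exponent monoid leaves \<open>q = m\<close>.\<close>
  also have "\<dots> = c * (\<Sum>q. Poly_Mapping.lookup f q when m = q)"
    by (simp only: Sum_any_when_equal' add_left_cancel)
  also have "\<dots> = c * Poly_Mapping.lookup f m"
    by (simp only: Sum_any_when_equal')
  finally show ?thesis .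
qed

text \<open>A shift of exponents is injective, so no terms cancel. Equality rather than inclusion is
  what later allows membership of a product in the ideal to be tested term by term.\<close>

lemma keys_single_mult:
  "Poly_Mapping.keys (Poly_Mapping.single t 1 * f) = (+) t ` Poly_Mapping.keys f"
  for f :: "('v, 'k::field) mpoly"
proof
  show "Poly_Mapping.keys (Poly_Mapping.single t 1 * f) \<subseteq> (+) t ` Poly_Mapping.keys f"
    using keys_mult[of "Poly_Mapping.single t 1" f] by auto
  show "(+) t ` Poly_Mapping.keys f \<subseteq> Poly_Mapping.keys (Poly_Mapping.single t 1 * f)"
    by (auto simp: in_keys_iff lookup_single_mult)
qed

lemma ideal_keys_subset:
  fixes B :: "('v \<Rightarrow>\<^sub>0 nat) set"
  assumes "\<And>u m. m \<in> B \<Longrightarrow> u + m \<in> B"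
  shows "ideal {f. Poly_Mapping.keys f \<subseteq> B} (mpoly_ring :: ('v, 'k::field) mpoly ring)"
proof (rule idealI)
  let ?I = "{f :: ('v, 'k) mpoly. Poly_Mapping.keys f \<subseteq> B}"
  show "ring (mpoly_ring :: ('v, 'k) mpoly ring)" by (rule mpoly.ring_axioms)
  have mult: "x * f \<in> ?I" if "f \<in> ?I" for x f :: "('v, 'k) mpoly"
    using keys_mult[of x f] that assms by blast
  show "subgroup ?I (add_monoid mpoly_ring)"
  proof (rule mpoly.add.subgroupI)
    show "x \<oplus>\<^bsub>mpoly_ring\<^esub> y \<in> ?I" if "x \<in> ?I" "y \<in> ?I" for x y
      using that Poly_Mapping.keys_add[of x y] by auto
    show "\<ominus>\<^bsub>mpoly_ring\<^esub> x \<in> ?I" if "x \<in> ?I" for x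
      using mult[OF that, of "-1"] by simp
    show "?I \<noteq> {}" by (auto intro!: exI[of _ 0])
  qed simp
  show "x \<otimes>\<^bsub>mpoly_ring\<^esub> f \<in> ?I" if "f \<in> ?I" for f x
    using mult[OF that, of x] by simp
  show "f \<otimes>\<^bsub>mpoly_ring\<^esub> x \<in> ?I" if "f \<in> ?I" for f x
    using mult[OF that, of x] by (simp add: mult.commute)
qed

text \<open>A polynomial is the finite sum of its terms, so single terms suffice. This yields the
  lower bound for the ideal in \<open>artinian_ideal_eq\<close>.\<close>

lemma single_mem_ideal_imp_subset:
  fixes J :: "('v, 'k::field) mpoly set"
  assumes "ideal J mpoly_ring" and "\<And>m c. m \<in> B \<Longrightarrow> Poly_Mapping.single m c \<in> J"
  shows "{f. Poly_Mapping.keys f \<subseteq> B} \<subseteq> J"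
proof -
  interpret J: ideal J "mpoly_ring :: ('v, 'k) mpoly ring" by fact
  have "Poly_Mapping.keys f \<subseteq> B \<longrightarrow> f \<in> J" for f :: "('v, 'k) mpoly"
  proof (induction f rule: update_induct)
    case const
    show ?case using J.zero_closed by simp
  next
    case (update f m c)
    have "Poly_Mapping.update m c f = Poly_Mapping.single m c + f"
      using update.hyps
      by (intro poly_mapping_eqI) (auto simp: lookup_update lookup_add lookup_single in_keys_iff)
    moreover have "Poly_Mapping.keys (Poly_Mapping.update m c f) = insert m (Poly_Mapping.keys f)"
      using update.hyps by (simp add: keys_update)
    ultimately show ?case
      using update.IH assms(2)[of m c] J.a_closed[of "Poly_Mapping.single m c" f] by simp
  qed
  then show ?thesis by blast
qed

section \<open>Residue classes and the field of constants\<close>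

lemma residue_class_eq_iff:
  assumes "ideal I mpoly_ring"
  shows "residue_class I f = residue_class I g \<longleftrightarrow> f - g \<in> I"
proof -
  interpret ideal I mpoly_ring by fact
  have "residue_class I f = residue_class I g \<longleftrightarrow> f \<in> I +>\<^bsub>mpoly_ring\<^esub> g"
    unfolding residue_class_def
    using a_repr_independence'[of f g] a_repr_independenceD[of f g] by auto
  then show ?thesis
    using a_rcos_module[of g f] by (simp add: a_minus_def)
qed

lemma carrier_quotient_algebra: "carrier (quotient_algebra I) = range (residue_class I)"
  by (auto simp: FactRing_def A_RCOSETS_def' residue_class_def)

lemma residue_class_hom:
  assumes "ideal I mpoly_ring"
  shows "ring_hom_ring mpoly_ring (quotient_algebra I) (residue_class I)"
  using ideal.rcos_ring_hom_ring[OF assms] unfolding residue_class_def[abs_def] .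

lemma residue_class_ops:
  assumes "ideal I mpoly_ring"
  shows "residue_class I f \<otimes>\<^bsub>quotient_algebra I\<^esub> residue_class I g = residue_class I (f * g)"
    and "residue_class I f \<oplus>\<^bsub>quotient_algebra I\<^esub> residue_class I g = residue_class I (f + g)"
    and "\<zero>\<^bsub>quotient_algebra I\<^esub> = residue_class I 0"
    and "\<one>\<^bsub>quotient_algebra I\<^esub> = residue_class I 1"
proof -
  interpret ring_hom_ring mpoly_ring "quotient_algebra I" "residue_class I"
    by (rule residue_class_hom) fact
  show "residue_class I f \<otimes>\<^bsub>quotient_algebra I\<^esub> residue_class I g = residue_class I (f * g)"
    "residue_class I f \<oplus>\<^bsub>quotient_algebra I\<^esub> residue_class I g = residue_class I (f + g)"
    "\<zero>\<^bsub>quotient_algebra I\<^esub> = residue_class I 0"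
    "\<one>\<^bsub>quotient_algebra I\<^esub> = residue_class I 1"
    using hom_mult[of f g] hom_add[of f g] hom_zero hom_one by simp_all
qed

text \<open>The image of a field under a ring homomorphism into a nonzero ring is a subfield;
  \<open>1 \<notin> I\<close> makes the quotient nonzero.\<close>

lemma subfield_constants:
  fixes I :: "('v, 'k::field) mpoly set"
  assumes "ideal I mpoly_ring" and "1 \<notin> I"
  shows "subfield (residue_class I ` range const) (quotient_algebra I)"
proof -
  interpret k: field "ring_of_type_algebra :: 'k ring" by (rule field_from_type_algebra)
  interpret Q: ring "quotient_algebra I" by (rule ideal.quotient_is_ring) fact
  have carrier_k: "carrier (ring_of_type_algebra :: 'k ring) = UNIV"
    by (simp add: ring_of_type_algebra_def)
  interpret h: ring_hom_ring "ring_of_type_algebra :: 'k ring" "quotient_algebra I"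
    "\<lambda>c. residue_class I (const c)"
  proof (rule ring_hom_ringI)
    show "ring (ring_of_type_algebra :: 'k ring)" by (rule k.ring_axioms)
    show "ring (quotient_algebra I)" by (rule Q.ring_axioms)
  qed (simp_all add: residue_class_ops[OF assms(1)] carrier_quotient_algebra const_def
        ring_of_type_algebra_def[where 'a = 'k] mult_single single_add)
  have "\<one>\<^bsub>quotient_algebra I\<^esub> \<noteq> \<zero>\<^bsub>quotient_algebra I\<^esub>"
    using assms by (simp add: residue_class_ops residue_class_eq_iff)
  then show ?thesis
    using h.img_is_subfield(2)[OF k.carrier_is_subfield] by (simp add: image_image carrier_k)
qed

subsection \<open>Artinian monomial ideals\<close>

abbreviation total_degree :: "('v::finite \<Rightarrow>\<^sub>0 nat) \<Rightarrow> nat" where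
  "total_degree m \<equiv> \<Sum>i\<in>UNIV. Poly_Mapping.lookup m i"

lemma total_degree_single_add: "total_degree (Poly_Mapping.single i 1 + m) = Suc (total_degree m)"
  by (simp add: lookup_add sum.distrib lookup_single when_def)

text \<open>\<open>B\<close> collects the exponents of the monomials in \<open>I\<close>. Its
  complement indexes a basis of the quotient: \<open>zero_notin\<close> makes the quotient nonzero
  and \<open>finite_compl\<close> makes it finite-dimensional.\<close>

locale artinian_monomial_ideal =
  fixes B :: "('v::finite \<Rightarrow>\<^sub>0 nat) set" and I :: "('v, 'k::field) mpoly set"
  assumes I_eq: "I = {f. Poly_Mapping.keys f \<subseteq> B}"
    and add_mem: "m \<in> B \<Longrightarrow> u + m \<in> B"
    and zero_notin: "0 \<notin> B"
    and finite_compl: "finite (- B)"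
begin

abbreviation monomial_class :: "('v \<Rightarrow>\<^sub>0 nat) \<Rightarrow> ('v, 'k) mpoly set" where
  "monomial_class m \<equiv> residue_class I (Poly_Mapping.single m 1)"

definition socle_exponents :: "('v \<Rightarrow>\<^sub>0 nat) set" where
  "socle_exponents = {m. m \<notin> B \<and> (\<forall>i. Poly_Mapping.single i 1 + m \<in> B)}"

definition socle_exponents_of_degree :: "nat \<Rightarrow> ('v \<Rightarrow>\<^sub>0 nat) set" where
  "socle_exponents_of_degree d = {m \<in> socle_exponents. total_degree m = d}"

lemma ideal_I: "ideal I mpoly_ring"
  unfolding I_eq using add_mem by (rule ideal_keys_subset)

lemma one_notin: "1 \<notin> I"
  using zero_notin by (simp add: I_eq)

lemmas class_eq_iff = residue_class_eq_iff[OF ideal_I]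

lemmas class_ops = residue_class_ops[OF ideal_I]

lemma single_mem_iff: "Poly_Mapping.single m c \<in> I \<longleftrightarrow> c = 0 \<or> m \<in> B"
  by (simp add: I_eq)

section \<open>The socle in each degree and its dimension\<close>

lemma exists_normal_form:
  obtains g where "residue_class I f = residue_class I g"
    and "Poly_Mapping.keys g = Poly_Mapping.keys f - B"
proof
  \<comment> \<open>Deleting the terms with exponent in \<open>B\<close> changes \<open>f\<close> by
    an element of \<open>I\<close> only, and creates no new exponents, so homogeneity is
    preserved.\<close>
  define g where "g = Poly_Mapping.mapp (\<lambda>m c. if m \<in> B then 0 else c) f"
  show "Poly_Mapping.keys g = Poly_Mapping.keys f - B"
    by (auto simp: g_def in_keys_iff lookup_mapp when_def)
  have "Poly_Mapping.keys (f - g) \<subseteq> B"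
    by (auto simp: g_def in_keys_iff lookup_mapp lookup_minus when_def split: if_splits)
  then show "residue_class I f = residue_class I g"
    by (simp add: class_eq_iff) (simp add: I_eq)
qed

text \<open>Distinct terms of \<open>f\<close> stay distinct after multiplication by a variable, so
  no cancellation can bring the product into \<open>I\<close>. Hence the socle condition is a
  condition on single monomials.\<close>

lemma mult_var_mem_iff:
  "f * var i \<in> I \<longleftrightarrow> (\<forall>m\<in>Poly_Mapping.keys f. Poly_Mapping.single i 1 + m \<in> B)"
  by (auto simp: var_def mult.commute[of f] keys_single_mult I_eq)

lemma socle_inter_graded_piece:
  "socle I \<inter> graded_piece I d =
    residue_class I ` {f. Poly_Mapping.keys f \<subseteq> socle_exponents_of_degree d}"
proof (intro equalityI subsetI)
  fix c assume "c \<in> socle I \<inter> graded_piece I d"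
  then obtain f where f: "c = residue_class I f" "homogeneous d f"
    and soc: "\<And>i. residue_class I f \<otimes>\<^bsub>quotient_algebra I\<^esub> residue_class I (var i)
      = \<zero>\<^bsub>quotient_algebra I\<^esub>"
    by (auto simp: socle_def graded_piece_def)
  \<comment> \<open>The representative \<open>f\<close> may have terms in \<open>B\<close>, which
    are not socle exponents; the normal form removes them.\<close>
  obtain g where g: "residue_class I f = residue_class I g"
    "Poly_Mapping.keys g = Poly_Mapping.keys f - B"
    by (rule exists_normal_form)
  have "Poly_Mapping.single i 1 + m \<in> B" if "m \<in> Poly_Mapping.keys f" for i m
    using soc[of i] that by (simp add: class_ops class_eq_iff mult_var_mem_iff)
  then have "Poly_Mapping.keys g \<subseteq> socle_exponents_of_degree d"
    using f(2) g(2)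
    by (auto simp: socle_exponents_of_degree_def socle_exponents_def homogeneous_def)
  then show "c \<in> residue_class I ` {f. Poly_Mapping.keys f \<subseteq> socle_exponents_of_degree d}"
    using f(1) g(1) by blast
next
  fix c assume "c \<in> residue_class I ` {f. Poly_Mapping.keys f \<subseteq> socle_exponents_of_degree d}"
  then obtain f where "c = residue_class I f"
    "Poly_Mapping.keys f \<subseteq> socle_exponents_of_degree d" by blast
  then show "c \<in> socle I \<inter> graded_piece I d"
    by (auto simp: socle_def graded_piece_def homogeneous_def carrier_quotient_algebra class_ops
        class_eq_iff mult_var_mem_iff socle_exponents_of_degree_def socle_exponents_def subset_iff)
qed

text \<open>Induction on \<open>M\<close>: each new monomial extends the span by one line. Its class
  is independent of the earlier ones because a relation would be a polynomial in \<open>I\<close>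
  with a key outside \<open>B\<close>.\<close>

lemma dimension_monomial_span:
  assumes "finite M" and "M \<inter> B = {}"
  shows "ring.dimension (quotient_algebra I) (card M) (residue_class I ` range const)
    (residue_class I ` {f. Poly_Mapping.keys f \<subseteq> M})"
proof -
  interpret Q: ring "quotient_algebra I" by (rule ideal.quotient_is_ring[OF ideal_I])
  let ?K = "residue_class I ` range const"
  let ?E = "\<lambda>M. residue_class I ` {f. Poly_Mapping.keys f \<subseteq> M}"
  show ?thesis
    using assms
  proof (induction M rule: finite_induct)
    case empty
    have "?E {} = {\<zero>\<^bsub>quotient_algebra I\<^esub>}"
      by (auto simp: class_ops)
    then show ?case using Q.zero_dim by simp
  next
    case (insert m M)
    have "?E (insert m M) = Q.line_extension ?K (monomial_class m) (?E M)"
    proof (intro equalityI subsetI)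
      fix c assume "c \<in> ?E (insert m M)"
      then obtain f where f: "c = residue_class I f" "Poly_Mapping.keys f \<subseteq> insert m M" by blast
      define g where "g = f - Poly_Mapping.single m (Poly_Mapping.lookup f m)"
      have "Poly_Mapping.keys g \<subseteq> M"
        using f(2) by (auto simp: g_def in_keys_iff lookup_minus lookup_single when_def split: if_splits)
      moreover have "c = residue_class I (const (Poly_Mapping.lookup f m))
          \<otimes>\<^bsub>quotient_algebra I\<^esub> monomial_class m \<oplus>\<^bsub>quotient_algebra I\<^esub> residue_class I g"
        by (simp add: f(1) class_ops g_def const_def mult_single)
      ultimately show "c \<in> Q.line_extension ?K (monomial_class m) (?E M)"
        unfolding Q.line_extension_mem_iff by blast
    next
      fix c assume "c \<in> Q.line_extension ?K (monomial_class m) (?E M)"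
      then obtain k f where f: "Poly_Mapping.keys f \<subseteq> M" and "c = residue_class I (const k)
          \<otimes>\<^bsub>quotient_algebra I\<^esub> monomial_class m \<oplus>\<^bsub>quotient_algebra I\<^esub> residue_class I f"
        unfolding Q.line_extension_mem_iff by blast
      then have "c = residue_class I (Poly_Mapping.single m k + f)"
        by (simp add: class_ops const_def mult_single)
      moreover have "Poly_Mapping.keys (Poly_Mapping.single m k + f) \<subseteq> insert m M"
        using f Poly_Mapping.keys_add[of "Poly_Mapping.single m k" f]
        by (auto split: if_splits)
      ultimately show "c \<in> ?E (insert m M)" by blast
    qed
    moreover have "monomial_class m \<notin> ?E M"
    proof
      assume "monomial_class m \<in> ?E M"
      then obtain f where f: "Poly_Mapping.keys f \<subseteq> M" "Poly_Mapping.single m 1 - f \<in> I"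
        by (auto simp: class_eq_iff)
      then have "m \<in> Poly_Mapping.keys (Poly_Mapping.single m 1 - f)"
        using insert.hyps(2) by (auto simp: in_keys_iff lookup_minus subset_iff)
      then show False
        using f(2) insert.prems by (auto simp: I_eq)
    qed
    moreover have "monomial_class m \<in> carrier (quotient_algebra I)"
      by (simp add: carrier_quotient_algebra)
    ultimately show ?case
      using Q.Suc_dim insert by simp
  qed
qed

lemma finite_socle_exponents: "finite socle_exponents"
  by (rule finite_subset[OF _ finite_compl]) (auto simp: socle_exponents_def)

lemma k_dim_socle: "k_dim I (socle I \<inter> graded_piece I d) = card (socle_exponents_of_degree d)"
proof -
  interpret Q: ring "quotient_algebra I" by (rule ideal.quotient_is_ring[OF ideal_I])
  have "finite (socle_exponents_of_degree d)"
    using finite_socle_exponents by (simp add: socle_exponents_of_degree_def)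
  moreover have "socle_exponents_of_degree d \<inter> B = {}"
    by (auto simp: socle_exponents_of_degree_def socle_exponents_def)
  \<comment> \<open>\<open>dimI\<close> passes from the inductive predicate \<open>dimension\<close>
    to the value of \<open>dim\<close>; this is where the constants must form a subfield.\<close>
  ultimately show ?thesis
    using Q.dimI[OF subfield_constants[OF ideal_I one_notin] dimension_monomial_span]
    by (simp add: k_dim_def socle_inter_graded_piece over_def)
qed

section \<open>Socle degree, type and the Gorenstein property\<close>

lemma graded_piece_nonzero_iff:
  "graded_piece I d \<noteq> {\<zero>\<^bsub>quotient_algebra I\<^esub>} \<longleftrightarrow> d \<in> total_degree ` (- B)"
proof
  assume "graded_piece I d \<noteq> {\<zero>\<^bsub>quotient_algebra I\<^esub>}"
  moreover have "\<zero>\<^bsub>quotient_algebra I\<^esub> \<in> graded_piece I d"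
    by (auto simp: graded_piece_def class_ops homogeneous_def)
  ultimately obtain f where "homogeneous d f" "residue_class I f \<noteq> residue_class I 0"
    by (auto simp: graded_piece_def class_ops)
  moreover from this have "\<not> Poly_Mapping.keys f \<subseteq> B"
    by (simp add: class_eq_iff) (simp add: I_eq)
  ultimately show "d \<in> total_degree ` (- B)"
    by (auto simp: homogeneous_def)
next
  assume "d \<in> total_degree ` (- B)"
  then obtain m where m: "m \<notin> B" "total_degree m = d" by blast
  then have "monomial_class m \<in> graded_piece I d"
    by (auto simp: graded_piece_def homogeneous_def)
  moreover have "monomial_class m \<noteq> \<zero>\<^bsub>quotient_algebra I\<^esub>"
    using m(1) by (simp add: class_ops class_eq_iff single_mem_iff)
  ultimately show "graded_piece I d \<noteq> {\<zero>\<^bsub>quotient_algebra I\<^esub>}" by auto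
qed

lemma socle_degree_eq: "socle_degree I = Max (total_degree ` (- B))"
  by (simp add: socle_degree_def graded_piece_nonzero_iff)

lemma total_degree_le_socle_degree: "m \<notin> B \<Longrightarrow> total_degree m \<le> socle_degree I"
  using finite_compl by (simp add: socle_degree_eq)

lemma cm_type_eq: "cm_type I = card socle_exponents"
proof -
  have "cm_type I = (\<Sum>d<Suc (socle_degree I). card (socle_exponents_of_degree d))"
    by (simp only: cm_type_def socle_vector_def k_dim_socle sum_list_distinct_conv_sum_set
        distinct_upt set_upt atLeast0LessThan)
  also have "\<dots> = card (\<Union>d<Suc (socle_degree I). socle_exponents_of_degree d)"
    using finite_socle_exponents
    by (intro card_UN_disjoint[symmetric]) (auto simp: socle_exponents_of_degree_def)
  \<comment> \<open>No socle exponent has degree above \<open>socle_degree I\<close>, so cutting off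
    there loses nothing.\<close>
  also have "(\<Union>d<Suc (socle_degree I). socle_exponents_of_degree d) = socle_exponents"
    using total_degree_le_socle_degree
    by (fastforce simp: socle_exponents_of_degree_def socle_exponents_def less_Suc_eq_le)
  finally show ?thesis .
qed

text \<open>A monomial of largest degree outside \<open>B\<close> is killed by every variable, since
  the product would have larger degree.\<close>

lemma socle_exponents_top_degree: "socle_exponents_of_degree (socle_degree I) \<noteq> {}"
proof -
  have "socle_degree I \<in> total_degree ` (- B)"
    unfolding socle_degree_eq using finite_compl zero_notin by (intro Max_in) auto
  then obtain m where m: "m \<notin> B" "total_degree m = socle_degree I" by auto
  have "Poly_Mapping.single i 1 + m \<in> B" for i
    using total_degree_le_socle_degree[of "Poly_Mapping.single i 1 + m"] m(2)
    unfolding total_degree_single_add by auto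
  then have "m \<in> socle_exponents_of_degree (socle_degree I)"
    using m by (simp add: socle_exponents_of_degree_def socle_exponents_def)
  then show ?thesis by blast
qed

text \<open>The top entry of the socle vector is always positive, so total dimension one forces all
  lower entries to vanish.\<close>

lemma gorenstein_iff: "gorenstein I \<longleftrightarrow> cm_type I = 1"
proof
  assume "gorenstein I"
  then show "cm_type I = 1"
    by (simp add: gorenstein_def level_of_type_def cm_type_def sum_list_replicate)
next
  assume "cm_type I = 1"
  then obtain m where m: "socle_exponents = {m}"
    by (auto simp: cm_type_eq card_1_singleton_iff)
  then have deg: "total_degree m = socle_degree I"
    using socle_exponents_top_degree by (auto simp: socle_exponents_of_degree_def)
  then have top: "socle_exponents_of_degree (socle_degree I) = {m}"
    using m by (auto simp: socle_exponents_of_degree_def)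
  have "socle_exponents_of_degree d = {}" if "d < socle_degree I" for d
    using that m deg by (auto simp: socle_exponents_of_degree_def)
  then have "map (\<lambda>d. card (socle_exponents_of_degree d)) [0..<socle_degree I] =
      replicate (socle_degree I) 0"
    by (intro nth_equalityI) auto
  then show "gorenstein I"
    by (simp add: gorenstein_def level_of_type_def socle_vector_def k_dim_socle top)
qed

end

subsection \<open>The algebra of a simplicial complex\<close>

definition vanishing_exponents :: "'v set set \<Rightarrow> ('v \<Rightarrow> nat) \<Rightarrow> ('v \<Rightarrow>\<^sub>0 nat) set" where
  "vanishing_exponents \<Delta> a =
    {m. Poly_Mapping.keys m \<notin> \<Delta> \<or> (\<exists>i. a i \<le> Poly_Mapping.lookup m i)}"

lemma keys_add_nat:
  "Poly_Mapping.keys (u + m) = Poly_Mapping.keys u \<union> Poly_Mapping.keys m"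
  for u m :: "'v \<Rightarrow>\<^sub>0 nat"
  by (auto simp: in_keys_iff lookup_add)

lemma prod_var:
  "(\<Prod>i\<in>S. var i) = (Poly_Mapping.single (\<Sum>i\<in>S. Poly_Mapping.single i 1) 1 :: ('v, 'k::field) mpoly)"
  by (induction S rule: infinite_finite_induct) (simp_all add: var_def mult_single)

lemma var_power: "var i ^ n = (Poly_Mapping.single (Poly_Mapping.single i n) 1 :: ('v, 'k::field) mpoly)"
  by (induction n) (simp_all add: var_def mult_single flip: single_add)

lemma lookup_sum_single:
  "finite S \<Longrightarrow>
    Poly_Mapping.lookup (\<Sum>i\<in>S. Poly_Mapping.single i (c i)) j = (if j \<in> S then c j else 0)"
  by (simp add: lookup_sum lookup_single when_def)

text \<open>Adding exponents enlarges the support, and a superset of a nonface is a nonface; entries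
  at least \<open>a i\<close> stay so.\<close>

lemma vanishing_exponents_add:
  assumes "simplicial_complex \<Delta>" and "m \<in> vanishing_exponents \<Delta> a"
  shows "u + m \<in> vanishing_exponents \<Delta> a"
  using assms unfolding vanishing_exponents_def simplicial_complex_def
  by (auto simp: keys_add_nat lookup_add intro: trans_le_add2)

lemma finite_vanishing_exponents_compl:
  "finite (- vanishing_exponents \<Delta> (a :: 'v::finite \<Rightarrow> nat))"
proof (rule finite_imageD)
  show "finite (Poly_Mapping.lookup ` (- vanishing_exponents \<Delta> a))"
  proof (rule finite_subset)
    \<comment> \<open>The remaining exponent vectors lie in the finite box of functions with values
      below \<open>a\<close>.\<close>
    show "Poly_Mapping.lookup ` (- vanishing_exponents \<Delta> a) \<subseteq> Pi\<^sub>E UNIV (\<lambda>i. {..<a i})"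
      by (auto simp: vanishing_exponents_def not_le)
  qed (rule finite_PiE, simp_all)
  show "inj_on Poly_Mapping.lookup (- vanishing_exponents \<Delta> a)"
    by (rule inj_onI) (simp add: poly_mapping_eqI)
qed

text \<open>The generators have exponents in \<open>vanishing_exponents\<close>, giving one
  inclusion by minimality of generated ideals. Conversely, every monomial with such an exponent is
  divisible by a generator.\<close>

lemma artinian_ideal_eq:
  fixes \<Delta> :: "'v::finite set set"
  assumes "simplicial_complex \<Delta>"
  shows "(artinian_ideal \<Delta> a :: ('v, 'k::field) mpoly set) =
    {f. Poly_Mapping.keys f \<subseteq> vanishing_exponents \<Delta> a}" (is "?A = ?I")
proof
  define J where "J = (stanley_reisner_ideal \<Delta> :: ('v, 'k) mpoly set)"
  define P where "P = Idl\<^bsub>mpoly_ring\<^esub> {var i ^ a i :: ('v, 'k) mpoly | i. True}"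
  have A: "?A = J <+>\<^bsub>mpoly_ring\<^esub> P"
    by (simp add: artinian_ideal_def J_def P_def)
  interpret J: ideal J mpoly_ring
    unfolding J_def stanley_reisner_ideal_def by (rule mpoly.genideal_ideal) simp
  interpret P: ideal P mpoly_ring
    unfolding P_def by (rule mpoly.genideal_ideal) simp
  interpret I: ideal ?I mpoly_ring
    using assms by (intro ideal_keys_subset vanishing_exponents_add)
  have "J \<subseteq> ?I"
    unfolding J_def stanley_reisner_ideal_def
  proof (rule mpoly.genideal_minimal[OF I.is_ideal], safe)
    fix S m assume S: "S \<notin> \<Delta>" and "m \<in> Poly_Mapping.keys (\<Prod>i\<in>S. var i :: ('v, 'k) mpoly)"
    then have "m = (\<Sum>i\<in>S. Poly_Mapping.single i 1)" by (simp add: prod_var)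
    then have "Poly_Mapping.keys m = S"
      by (auto simp: in_keys_iff lookup_sum_single split: if_splits)
    then show "m \<in> vanishing_exponents \<Delta> a"
      using S by (simp add: vanishing_exponents_def)
  qed
  moreover have "P \<subseteq> ?I"
    unfolding P_def
  proof (rule mpoly.genideal_minimal[OF I.is_ideal], safe)
    fix i m assume "m \<in> Poly_Mapping.keys (var i ^ a i :: ('v, 'k) mpoly)"
    then have "a i \<le> Poly_Mapping.lookup m i" by (simp add: var_power)
    then show "m \<in> vanishing_exponents \<Delta> a"
      by (auto simp: vanishing_exponents_def)
  qed
  ultimately show "?A \<subseteq> ?I"
    unfolding A using I.a_closed by (fastforce simp: set_add_def' simp del: mem_Collect_eq)
  have JA: "J \<subseteq> ?A" and PA: "P \<subseteq> ?A"
    unfolding A set_add_def' using J.zero_closed P.zero_closed by force+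
  show "?I \<subseteq> ?A"
  proof (rule single_mem_ideal_imp_subset)
    show "ideal ?A mpoly_ring"
      unfolding A by (rule mpoly.add_ideals[OF J.is_ideal P.is_ideal])
    fix m c assume "m \<in> vanishing_exponents \<Delta> a"
    then consider "Poly_Mapping.keys m \<notin> \<Delta>" | i where "a i \<le> Poly_Mapping.lookup m i"
      by (auto simp: vanishing_exponents_def)
    then show "Poly_Mapping.single m c \<in> ?A"
    proof cases
      case 1
      \<comment> \<open>\<open>s\<close> is the exponent of the squarefree monomial on the support
        of \<open>m\<close>. Entries on the support are at least 1, so the truncated difference
        \<open>m - s\<close> is a true one.\<close>
      define s where "s = (\<Sum>i\<in>Poly_Mapping.keys m. Poly_Mapping.single i (1::nat))"
      have "m - s + s = m"
        by (intro poly_mapping_eqI)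
          (auto simp: s_def lookup_add lookup_minus lookup_sum_single in_keys_iff)
      moreover have "(\<Prod>i\<in>Poly_Mapping.keys m. var i) \<in> J"
        using 1 mpoly.genideal_self[of "{\<Prod>i\<in>S. var i | S. S \<notin> \<Delta>}"]
        unfolding J_def stanley_reisner_ideal_def by auto
      ultimately have "Poly_Mapping.single m c \<in> J"
        using J.I_l_closed[of "\<Prod>i\<in>Poly_Mapping.keys m. var i" "Poly_Mapping.single (m - s) c"]
        by (simp add: prod_var mult_single s_def)
      then show ?thesis using JA by blast
    next
      case 2
      have "m - Poly_Mapping.single i (a i) + Poly_Mapping.single i (a i) = m"
        using 2 by (intro poly_mapping_eqI) (auto simp: lookup_add lookup_minus lookup_single when_def)
      moreover have "var i ^ a i \<in> P"
        using mpoly.genideal_self[of "{var i ^ a i | i. True}"] unfolding P_def by auto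
      ultimately have "Poly_Mapping.single m c \<in> P"
        using P.I_l_closed[of "var i ^ a i" "Poly_Mapping.single (m - Poly_Mapping.single i (a i)) c"]
        by (simp add: var_power mult_single)
      then show ?thesis using PA by blast
    qed
  qed
qed

lemma artinian_monomial_ideal_simplicial_complex:
  fixes \<Delta> :: "'v::finite set set"
  assumes "simplicial_complex \<Delta>" and "\<forall>i. a i > 0"
  shows "artinian_monomial_ideal (vanishing_exponents \<Delta> a)
    (artinian_ideal \<Delta> a :: ('v, 'k::field) mpoly set)"
proof
  \<comment> \<open>The zero exponent has empty support, a face because it lies in some
    \<open>{i}\<close>.\<close>
  show "0 \<notin> vanishing_exponents \<Delta> a"
    using assms by (auto simp: vanishing_exponents_def simplicial_complex_def Suc_le_eq)
qed (use assms artinian_ideal_eq vanishing_exponents_add finite_vanishing_exponents_compl in auto)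

section \<open>Facets and socle monomials\<close>

lemma mem_facets_iff:
  assumes "simplicial_complex \<Delta>"
  shows "F \<in> facets \<Delta> \<longleftrightarrow> F \<in> \<Delta> \<and> (\<forall>j. j \<notin> F \<longrightarrow> insert j F \<notin> \<Delta>)"
proof
  assume F: "F \<in> \<Delta> \<and> (\<forall>j. j \<notin> F \<longrightarrow> insert j F \<notin> \<Delta>)"
  \<comment> \<open>Closure under subsets reduces maximality to adding one vertex, matching
    multiplication by one variable.\<close>
  have "G = F" if "G \<in> \<Delta>" "F \<subseteq> G" for G
  proof (rule ccontr)
    assume "G \<noteq> F"
    then obtain j where "j \<in> G" "j \<notin> F" using \<open>F \<subseteq> G\<close> by blast
    then have "insert j F \<in> \<Delta>"
      using that assms by (auto simp: simplicial_complex_def)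
    then show False using F \<open>j \<notin> F\<close> by blast
  qed
  then show "F \<in> facets \<Delta>" using F by (simp add: facets_def)
qed (auto simp: facets_def)

lemma mem_socle_exponents_iff:
  fixes \<Delta> :: "'v::finite set set"
  assumes "simplicial_complex \<Delta>" and a: "\<forall>i. a i \<ge> 2"
  shows "m \<in> artinian_monomial_ideal.socle_exponents (vanishing_exponents \<Delta> a) \<longleftrightarrow>
    Poly_Mapping.keys m \<in> facets \<Delta> \<and> (\<forall>i\<in>Poly_Mapping.keys m. Poly_Mapping.lookup m i = a i - 1)"
proof -
  \<comment> \<open>\<open>socle_exponents\<close> does not involve the field, so any field serves here.\<close>
  interpret artinian_monomial_ideal "vanishing_exponents \<Delta> a"
    "artinian_ideal \<Delta> a :: ('v, rat) mpoly set"
    using assms by (simp add: artinian_monomial_ideal_simplicial_complex less_le_trans[OF pos2])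
  have small: "m \<notin> vanishing_exponents \<Delta> a \<longleftrightarrow>
      Poly_Mapping.keys m \<in> \<Delta> \<and> (\<forall>i. Poly_Mapping.lookup m i < a i)"
    by (auto simp: vanishing_exponents_def not_le)
  have step: "Poly_Mapping.single i 1 + m \<in> vanishing_exponents \<Delta> a \<longleftrightarrow>
      (if i \<in> Poly_Mapping.keys m then Poly_Mapping.lookup m i = a i - 1
       else insert i (Poly_Mapping.keys m) \<notin> \<Delta>)"
    if "m \<notin> vanishing_exponents \<Delta> a" for i
  proof -
    have lt: "\<forall>j. Poly_Mapping.lookup m j < a j" "Poly_Mapping.keys m \<in> \<Delta>" using that small by auto
    have "(\<exists>j. a j \<le> Poly_Mapping.lookup (Poly_Mapping.single i 1 + m) j) \<longleftrightarrow>
        a i \<le> Suc (Poly_Mapping.lookup m i)"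
      using lt(1) by (auto simp: lookup_add lookup_single when_def not_le[symmetric] split: if_splits)
    \<comment> \<open>Here \<open>a i \<ge> 2\<close> matters: an exponent equal to
      \<open>a i - 1\<close> is nonzero, so \<open>i\<close> is in the support. Off the support the
      new exponent 1 is still below \<open>a i\<close>.\<close>
    also have "\<dots> \<longleftrightarrow> i \<in> Poly_Mapping.keys m \<and> Poly_Mapping.lookup m i = a i - 1"
      using lt(1)[rule_format, of i] a[rule_format, of i] by (auto simp: in_keys_iff)
    finally have "Poly_Mapping.single i 1 + m \<in> vanishing_exponents \<Delta> a \<longleftrightarrow>
      insert i (Poly_Mapping.keys m) \<notin> \<Delta> \<or> i \<in> Poly_Mapping.keys m \<and> Poly_Mapping.lookup m i = a i - 1"
      by (simp add: vanishing_exponents_def keys_add_nat)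
    \<comment> \<open>On the support the insertion changes nothing and the support is a face, so
      only the exponent condition remains.\<close>
    then show ?thesis
      using lt(2) by (auto simp: insert_absorb)
  qed
  have "\<forall>i. Poly_Mapping.lookup m i < a i"
    if "\<forall>i\<in>Poly_Mapping.keys m. Poly_Mapping.lookup m i = a i - 1"
  proof
    fix i show "Poly_Mapping.lookup m i < a i"
      using that a[rule_format, of i] by (cases "i \<in> Poly_Mapping.keys m") (auto simp: in_keys_iff)
  qed
  then show ?thesis
    unfolding socle_exponents_def mem_facets_iff[OF assms(1)]
    using small step by auto
qed

text \<open>Taking supports is a bijection onto the facets: the support of a socle monomial fixes
  all its exponents, and every facet is attained.\<close>

lemma card_socle_exponents:
  fixes \<Delta> :: "'v::finite set set"
  assumes "simplicial_complex \<Delta>" and "\<forall>i. a i \<ge> 2"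
  shows "card (artinian_monomial_ideal.socle_exponents (vanishing_exponents \<Delta> a)) = card (facets \<Delta>)"
proof (rule bij_betw_same_card)
  let ?S = "artinian_monomial_ideal.socle_exponents (vanishing_exponents \<Delta> a)"
  show "bij_betw Poly_Mapping.keys ?S (facets \<Delta>)"
  proof (rule bij_betw_imageI)
    show "inj_on Poly_Mapping.keys ?S"
    proof (rule inj_onI, rule poly_mapping_eqI)
      fix m m' i
      assume "m \<in> ?S" "m' \<in> ?S" "Poly_Mapping.keys m = Poly_Mapping.keys m'"
      then show "Poly_Mapping.lookup m i = Poly_Mapping.lookup m' i"
        unfolding mem_socle_exponents_iff[OF assms]
        by (metis in_keys_iff)
    qed
    show "Poly_Mapping.keys ` ?S = facets \<Delta>"
    proof (intro equalityI subsetI)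
      fix F assume F: "F \<in> facets \<Delta>"
      define m where "m = (\<Sum>i\<in>F. Poly_Mapping.single i (a i - 1))"
      have lookup: "Poly_Mapping.lookup m i = (if i \<in> F then a i - 1 else 0)" for i
        by (simp add: m_def lookup_sum_single)
      \<comment> \<open>Nonzero exponents on \<open>F\<close> ensure that the support of
        \<open>m\<close> is all of \<open>F\<close>.\<close>
      moreover have "a i - 1 \<noteq> 0" for i
        using assms(2)[rule_format, of i] by simp
      ultimately have "Poly_Mapping.keys m = F"
        by (auto simp: in_keys_iff split: if_splits)
      moreover from this have "m \<in> ?S"
        using F lookup by (simp add: mem_socle_exponents_iff[OF assms])
      ultimately show "F \<in> Poly_Mapping.keys ` ?S" by blast
    qed (auto simp: mem_socle_exponents_iff[OF assms])
  qed
qed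

theorem corollary3p4:
  fixes \<Delta> :: "'v::finite set set"
    and a :: "'v \<Rightarrow> nat"
  assumes "simplicial_complex \<Delta>"
    and "\<forall>F\<in>facets \<Delta>. card F \<noteq> 1"
    and "\<forall>i. a i \<ge> 2"
  shows "cm_type (artinian_ideal \<Delta> a :: ('v, 'k::field_char_0) mpoly set) = card (facets \<Delta>) \<and>
         (\<forall>b. (\<forall>i. b i \<ge> 2) \<longrightarrow>
            cm_type (artinian_ideal \<Delta> b :: ('v, 'k) mpoly set)
              = cm_type (artinian_ideal \<Delta> a :: ('v, 'k) mpoly set)) \<and>
         (gorenstein (artinian_ideal \<Delta> a :: ('v, 'k) mpoly set) \<longleftrightarrow> (\<exists>!F. F \<in> facets \<Delta>))"
proof -
  have loc: "artinian_monomial_ideal (vanishing_exponents \<Delta> b)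
      (artinian_ideal \<Delta> b :: ('v, 'k) mpoly set)" if "\<forall>i. b i \<ge> 2" for b
    using assms(1) that
    by (simp add: artinian_monomial_ideal_simplicial_complex less_le_trans[OF pos2])
  \<comment> \<open>Proved for arbitrary \<open>b\<close>, so that independence of the exponents
    follows by comparing two instances.\<close>
  have type: "cm_type (artinian_ideal \<Delta> b :: ('v, 'k) mpoly set) = card (facets \<Delta>)"
    if "\<forall>i. b i \<ge> 2" for b
    using artinian_monomial_ideal.cm_type_eq[OF loc[OF that]]
      card_socle_exponents[OF assms(1) that] by simp
  have "card (facets \<Delta>) = 1 \<longleftrightarrow> (\<exists>!F. F \<in> facets \<Delta>)"
    by (auto simp: card_1_singleton_iff)
  then show ?thesis
    using type assms(3) artinian_monomial_ideal.gorenstein_iff[OF loc[OF assms(3)]] by simp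
qed

end
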